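(* Let $u\colon\mathbb{R}^3\to\mathbb{O}$ have octonion Fourier transform $U$. Let $f_0\in\mathbb{R}$ and, for $i=1,2,3$, let $u^{\exp,i}(\mathbf{x})=u(\mathbf{x})\cdot\exp(-\mathbf{e}_{2^{i-1}}2\pi f_0x_i)$ and let $U^{\exp,i}$ be the octonion Fourier transform of $u^{\exp,i}$. Then for all $(f_1,f_2,f_3)\in\mathbb{R}^3$ $$\begin{aligned} U^{\exp,1}(f_1,f_2,f_3)&=U(f_1+f_0,f_2,f_3), \\ U^{\exp,2}(f_1,f_2,f_3)&=\big(U(f_1,f_2+f_0,f_3)+U(f_1,f_2-f_0,f_3) \\ &\qquad+U(-f_1,f_2+f_0,f_3)-U(-f_1,f_2-f_0,f_3)\big)\cdot\tfrac12, \\ U^{\exp,3}(f_1,f_2,f_3)&=\big(U(f_1,f_2,f_3+f_0)+U(f_1,f_2,f_3-f_0) \\ &\qquad+U(-f_1,-f_2,f_3+f_0)-U(-f_1,-f_2,f_3-f_0)\big)\cdot\tfrac12.\end{aligned}$$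
   Context: $\mathbb{O}$ denotes the real algebra of octonions with basis $1,\mathbf{e}_1,\dots,\mathbf{e}_7$: an octonion is a pair $(q_0,q_1)$ of quaternions (quaternion units $\mathbf{e}_1,\mathbf{e}_2,\mathbf{e}_3$ with $\mathbf{e}_1\mathbf{e}_2=\mathbf{e}_3$), with product $(q_0,q_1)\cdot(p_0,p_1)=(q_0p_0-p_1^*q_1,\;p_1q_0+q_1p_0^* )$, where $^*$ is quaternion conjugation, and $\mathbf{e}_4=(0,1)$, $\mathbf{e}_5=(0,\mathbf{e}_1)$, $\mathbf{e}_6=(0,\mathbf{e}_2)$, $\mathbf{e}_7=(0,\mathbf{e}_3)$. The product is neither commutative nor associative; products without brackets are evaluated from left to right, i.e. $abcd=((ab)c)d$. For an imaginary unit $\mathbf{e}_k$ and $\alpha\in\mathbb{R}$, $e^{\mathbf{e}_k\alpha}=\exp(\mathbf{e}_k\alpha)=\cos\alpha+\mathbf{e}_k\sin\alpha$. Integrals of octonion-valued functions are taken componentwise. The octonion Fourier transform (OFT) of a Lebesgue integrable $u\colon\mathbb{R}^3\to\mathbb{O}$ is $$U(\mathbf{f})=\int_{\mathbb{R}^3}u(\mathbf{x})\,e^{-\mathbf{e}_1 2\pi f_1x_1}\,e^{-\mathbf{e}_2 2\pi f_2x_2}\,e^{-\mathbf{e}_4 2\pi f_3x_3}\,d\mathbf{x},\qquad \mathbf{f}=(f_1,f_2,f_3)\in\mathbb{R}^3,$$ with multiplication from left to right. Standing assumption: $u$ is Lebesgue integrable, so that its OFT is well defined. *)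

theory Defs
  imports "HOL-Analysis.Analysis"
begin

section \<open>Quaternions\<close>

codatatype quaternion =
  Quaternion (qRe: real) (qIm1: real) (qIm2: real) (qIm3: real)

lemma quaternion_eqI [intro?]:
  "\<lbrakk>qRe x = qRe y; qIm1 x = qIm1 y; qIm2 x = qIm2 y; qIm3 x = qIm3 y\<rbrakk> \<Longrightarrow> x = y"
  by (rule quaternion.expand) simp

lemma quaternion_eq_iff:
  "x = y \<longleftrightarrow> qRe x = qRe y \<and> qIm1 x = qIm1 y \<and> qIm2 x = qIm2 y \<and> qIm3 x = qIm3 y"
  by (auto intro: quaternion_eqI)

instantiation quaternion :: real_vector
begin

primcorec zero_quaternion where
  "qRe 0 = 0" | "qIm1 0 = 0" | "qIm2 0 = 0" | "qIm3 0 = 0"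

primcorec plus_quaternion where
  "qRe (x + y) = qRe x + qRe y"
| "qIm1 (x + y) = qIm1 x + qIm1 y"
| "qIm2 (x + y) = qIm2 x + qIm2 y"
| "qIm3 (x + y) = qIm3 x + qIm3 y"

primcorec uminus_quaternion where
  "qRe (- x) = - qRe x"
| "qIm1 (- x) = - qIm1 x"
| "qIm2 (- x) = - qIm2 x"
| "qIm3 (- x) = - qIm3 x"

primcorec minus_quaternion where
  "qRe (x - y) = qRe x - qRe y"
| "qIm1 (x - y) = qIm1 x - qIm1 y"
| "qIm2 (x - y) = qIm2 x - qIm2 y"
| "qIm3 (x - y) = qIm3 x - qIm3 y"

primcorec scaleR_quaternion where
  "qRe (r *\<^sub>R x) = r * qRe x"
| "qIm1 (r *\<^sub>R x) = r * qIm1 x"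
| "qIm2 (r *\<^sub>R x) = r * qIm2 x"
| "qIm3 (r *\<^sub>R x) = r * qIm3 x"

instance
  by standard (simp_all add: quaternion_eq_iff algebra_simps)

end

instantiation quaternion :: "{one, times}"
begin

primcorec one_quaternion where
  "qRe 1 = 1" | "qIm1 1 = 0" | "qIm2 1 = 0" | "qIm3 1 = 0"

primcorec times_quaternion where
  "qRe (x * y) = qRe x * qRe y - qIm1 x * qIm1 y - qIm2 x * qIm2 y - qIm3 x * qIm3 y"
| "qIm1 (x * y) = qRe x * qIm1 y + qIm1 x * qRe y + qIm2 x * qIm3 y - qIm3 x * qIm2 y"
| "qIm2 (x * y) = qRe x * qIm2 y - qIm1 x * qIm3 y + qIm2 x * qRe y + qIm3 x * qIm1 y"
| "qIm3 (x * y) = qRe x * qIm3 y + qIm1 x * qIm2 y - qIm2 x * qIm1 y + qIm3 x * qRe y"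

instance ..

end

instance quaternion :: real_algebra_1
  by standard (simp_all add: quaternion_eq_iff algebra_simps)

primcorec qcnj :: "quaternion \<Rightarrow> quaternion" where
  "qRe (qcnj x) = qRe x"
| "qIm1 (qcnj x) = - qIm1 x"
| "qIm2 (qcnj x) = - qIm2 x"
| "qIm3 (qcnj x) = - qIm3 x"

definition qi :: quaternion where "qi = Quaternion 0 1 0 0"
definition qj :: quaternion where "qj = Quaternion 0 0 1 0"
definition qk :: quaternion where "qk = Quaternion 0 0 0 1"

lemma qunit_sel [simp]:
  "qRe qi = 0" "qIm1 qi = 1" "qIm2 qi = 0" "qIm3 qi = 0"
  "qRe qj = 0" "qIm1 qj = 0" "qIm2 qj = 1" "qIm3 qj = 0"
  "qRe qk = 0" "qIm1 qk = 0" "qIm2 qk = 0" "qIm3 qk = 1"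
  by (simp_all add: qi_def qj_def qk_def)

lemma quaternion_units_mult:
  "qi * qi = -1" "qj * qj = -1" "qk * qk = -1"
  "qi * qj = qk" "qj * qk = qi" "qk * qi = qj"
  "qj * qi = - qk" "qk * qj = - qi" "qi * qk = - qj"
  by (simp_all add: quaternion_eq_iff)


section \<open>Octonions\<close>

codatatype octonion = Octonion (ofst: quaternion) (osnd: quaternion)

lemma octonion_eqI [intro?]: "\<lbrakk>ofst x = ofst y; osnd x = osnd y\<rbrakk> \<Longrightarrow> x = y"
  by (rule octonion.expand) simp

lemma octonion_eq_iff: "x = y \<longleftrightarrow> ofst x = ofst y \<and> osnd x = osnd y"
  by (auto intro: octonion_eqI)

instantiation octonion :: real_vector
begin

primcorec zero_octonion where
  "ofst 0 = 0" | "osnd 0 = 0"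

primcorec plus_octonion where
  "ofst (x + y) = ofst x + ofst y"
| "osnd (x + y) = osnd x + osnd y"

primcorec uminus_octonion where
  "ofst (- x) = - ofst x"
| "osnd (- x) = - osnd x"

primcorec minus_octonion where
  "ofst (x - y) = ofst x - ofst y"
| "osnd (x - y) = osnd x - osnd y"

primcorec scaleR_octonion where
  "ofst (r *\<^sub>R x) = r *\<^sub>R ofst x"
| "osnd (r *\<^sub>R x) = r *\<^sub>R osnd x"

instance
  by standard (simp_all add: octonion_eq_iff algebra_simps)

end

text \<open>
  The Cayley--Dickson product is not associative, so \<^typ>\<open>octonion\<close> is not an instance of the ring
  classes. Since \<open>*\<close> associates to the left, \<open>a * b * c * d\<close> means \<open>((a * b) * c) * d\<close>.
\<close>

instantiation octonion :: "{one, times}"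
begin

primcorec one_octonion where
  "ofst 1 = 1" | "osnd 1 = 0"

primcorec times_octonion where
  "ofst (q * p) = ofst q * ofst p - qcnj (osnd p) * osnd q"
| "osnd (q * p) = osnd p * ofst q + osnd q * qcnj (ofst p)"

instance ..

end

definition e1 :: octonion where "e1 = Octonion qi 0"
definition e2 :: octonion where "e2 = Octonion qj 0"
definition e3 :: octonion where "e3 = Octonion qk 0"
definition e4 :: octonion where "e4 = Octonion 0 1"
definition e5 :: octonion where "e5 = Octonion 0 qi"
definition e6 :: octonion where "e6 = Octonion 0 qj"
definition e7 :: octonion where "e7 = Octonion 0 qk"

lemmas octonion_unit_defs = e1_def e2_def e3_def e4_def e5_def e6_def e7_def

lemma octonion_units_mult:
  "e1 * e2 = e3" "e1 * e4 = e5" "e2 * e4 = e6" "e3 * e4 = e7"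
  "e2 * e1 = - e3" "e4 * e1 = - e5" "e4 * e2 = - e6" "e4 * e3 = - e7"
  "e1 * e1 = - 1" "e2 * e2 = - 1" "e4 * e4 = - 1"
  by (simp_all add: octonion_unit_defs octonion_eq_iff quaternion_eq_iff)


subsection \<open>Euclidean structure\<close>

text \<open>
  The Euclidean structure makes the Bochner integral available. It commutes with the (bounded
  linear) coordinate functionals, so integrability and the integral are componentwise.
\<close>

instantiation octonion :: real_inner
begin

definition inner_octonion :: "octonion \<Rightarrow> octonion \<Rightarrow> real" where
  "inner_octonion x y =
     qRe (ofst x) * qRe (ofst y) + qIm1 (ofst x) * qIm1 (ofst y)
   + qIm2 (ofst x) * qIm2 (ofst y) + qIm3 (ofst x) * qIm3 (ofst y)
   + qRe (osnd x) * qRe (osnd y) + qIm1 (osnd x) * qIm1 (osnd y)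
   + qIm2 (osnd x) * qIm2 (osnd y) + qIm3 (osnd x) * qIm3 (osnd y)"

definition norm_octonion :: "octonion \<Rightarrow> real" where
  "norm_octonion x = sqrt (x \<bullet> x)"

definition sgn_octonion :: "octonion \<Rightarrow> octonion" where
  "sgn_octonion x = x /\<^sub>R norm x"

definition dist_octonion :: "octonion \<Rightarrow> octonion \<Rightarrow> real" where
  "dist_octonion x y = norm (x - y)"

definition uniformity_octonion :: "(octonion \<times> octonion) filter" where
  "uniformity_octonion = (INF e\<in>{0 <..}. principal {(x, y). dist x y < e})"

definition open_octonion :: "octonion set \<Rightarrow> bool" where
  "open_octonion U \<longleftrightarrow> (\<forall>x\<in>U. eventually (\<lambda>(x', y). x' = x \<longrightarrow> y \<in> U) uniformity)"

instance
proof
  fix x y z :: octonion and r :: real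
  show "0 \<le> x \<bullet> x"
    by (simp add: inner_octonion_def)
  show "x \<bullet> x = 0 \<longleftrightarrow> x = 0"
    by (simp add: inner_octonion_def octonion_eq_iff quaternion_eq_iff add_nonneg_eq_0_iff conj_ac)
qed (simp_all add: inner_octonion_def norm_octonion_def sgn_octonion_def dist_octonion_def
       uniformity_octonion_def open_octonion_def algebra_simps)

end

instantiation octonion :: euclidean_space
begin

definition Basis_octonion :: "octonion set" where
  "Basis_octonion = {1, e1, e2, e3, e4, e5, e6, e7}"

instance
proof
  fix x y :: octonion
  show "(Basis :: octonion set) \<noteq> {}" "finite (Basis :: octonion set)"
    by (simp_all add: Basis_octonion_def)
  show "x \<bullet> y = (if x = y then 1 else 0)" if "x \<in> Basis" "y \<in> Basis"
    using that unfolding Basis_octonion_def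
    by (elim insertE emptyE)
      (simp_all add: inner_octonion_def octonion_unit_defs octonion_eq_iff quaternion_eq_iff)
  show "(\<forall>u\<in>Basis. x \<bullet> u = 0) \<longleftrightarrow> x = 0"
    unfolding Basis_octonion_def ball_simps
    by (simp add: inner_octonion_def octonion_unit_defs)
      (auto simp: octonion_eq_iff quaternion_eq_iff)
qed

end


section \<open>The octonion Fourier transform\<close>

text \<open>
  \<open>uexp e \<alpha>\<close> is $e^{\mathbf{e}\alpha}$ for an imaginary unit \<open>e\<close>; the library's \<^const>\<open>exp\<close> requires
  an associative algebra.
\<close>

definition uexp :: "octonion \<Rightarrow> real \<Rightarrow> octonion" where
  "uexp e \<alpha> = cos \<alpha> *\<^sub>R 1 + sin \<alpha> *\<^sub>R e"

definition OFT :: "(real^3 \<Rightarrow> octonion) \<Rightarrow> real^3 \<Rightarrow> octonion" where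
  "OFT u f = (LINT x|lebesgue.
     u x * uexp e1 (- (2 * pi * f$1 * x$1))
         * uexp e2 (- (2 * pi * f$2 * x$2))
         * uexp e4 (- (2 * pi * f$3 * x$3)))"

end

theory Submission
  imports Defs
begin

text \<open>
  Octonions are not associative, but they are right alternative: \<open>x * y * y = x * (y * y)\<close>.
  Polarising this identity shows that, for imaginary units \<open>d\<close> and \<open>e\<close> with \<open>e * d = - (d * e)\<close>, the
  operators of right multiplication by \<open>d\<close> and by \<open>e\<close> anticommute, and each of them squares
  to \<open>-1\<close>. The iterated products in the transform are therefore governed by the Clifford relations
  of these operators.

  Two rules follow. Factors with the same unit merge by adding their angles
  (\<open>mult_uexp_uexp\<close>). A factor \<open>uexp e a\<close> that moves rightwards past an anticommuting unit \<open>d\<close> has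
  its angle reversed (\<open>mult_uexp_unit\<close>); so when it moves past \<open>uexp d \<alpha> = cos \<alpha> + d sin \<alpha>\<close>, it
  keeps its angle on the cosine part (even in \<open>\<alpha>\<close>) and reverses it on the sine part (odd
  in \<open>\<alpha>\<close>). Writing the even and odd parts as half the sum and half the difference of the values at \<open>\<alpha>\<close> and \<open>-\<alpha>\<close> gives the
  combination of four terms (\<open>uexp_past_uexp\<close>); past two such factors the joint parity
  decides (\<open>uexp_past_two_uexp\<close>). The modulating factor thus reaches the factor with its own
  unit, merges with it, and shifts the corresponding frequency, while \<open>\<alpha> \<mapsto> -\<alpha>\<close> reflects the other
  frequencies. All three formulas are identities between the integrands; integrability of
  each term is what permits splitting the integral.
\<close>

section \<open>Right multiplication of octonions\<close>

lemma bounded_bilinear_octonion_mult: "bounded_bilinear ((*) :: octonion \<Rightarrow> octonion \<Rightarrow> octonion)"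
proof -
  have "linear (\<lambda>y :: octonion. x * y)" "linear (\<lambda>y. y * x)" for x :: octonion
    by (auto intro!: linearI simp: octonion_eq_iff quaternion_eq_iff algebra_simps)
  then show ?thesis
    by (simp add: bilinear_def flip: bilinear_conv_bounded_bilinear)
qed

interpretation octonion_mult: bounded_bilinear "(*) :: octonion \<Rightarrow> octonion \<Rightarrow> octonion"
  by (fact bounded_bilinear_octonion_mult)

lemmas octonion_bilinear_simps =
  octonion_mult.add_left octonion_mult.add_right octonion_mult.diff_left octonion_mult.diff_right
  octonion_mult.minus_left octonion_mult.minus_right
  octonion_mult.scaleR_left octonion_mult.scaleR_right

lemma octonion_mult_1_right [simp]: "x * 1 = x" for x :: octonion
  by (simp add: octonion_eq_iff quaternion_eq_iff)

text \<open>
  With \<open>y = (r, s)\<close>, the real number \<open>r + r\<^sup>*\<close> and the squared norm \<open>s\<^sup>* s = s s\<^sup>*\<close> are central, and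
  modulo this the identity holds by associativity of the quaternions.
\<close>

lemma octonion_right_alternative: "x * y * y = x * (y * y)" for x y :: octonion
proof -
  define p q r s where "p = ofst x" and "q = osnd x" and "r = ofst y" and "s = osnd y"
  define n where "n = (qRe s)\<^sup>2 + (qIm1 s)\<^sup>2 + (qIm2 s)\<^sup>2 + (qIm3 s)\<^sup>2"
  have trace: "qcnj r = (2 * qRe r) *\<^sub>R 1 - r"
    by (simp add: quaternion_eq_iff)
  have norm: "qcnj s * s = n *\<^sub>R 1" "s * qcnj s = n *\<^sub>R 1"
    by (simp_all add: n_def quaternion_eq_iff power2_eq_square algebra_simps)
  have norm': "qcnj s * (s * z) = n *\<^sub>R z" "s * (qcnj s * z) = n *\<^sub>R z" for z
    by (simp_all add: norm flip: mult.assoc)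
  have square: "qcnj (r * r - n *\<^sub>R 1) = qcnj r * qcnj r - n *\<^sub>R 1"
    by (simp add: quaternion_eq_iff algebra_simps)
  have sum: "s * r + s * qcnj r = (2 * qRe r) *\<^sub>R s"
    unfolding trace by (simp add: algebra_simps)
  have cnj_scaleR: "qcnj (c *\<^sub>R s) = c *\<^sub>R qcnj s" for c
    by (simp add: quaternion_eq_iff)
  have "(p * r - qcnj s * q) * r - qcnj s * (s * p + q * qcnj r)
      = p * (r * r - n *\<^sub>R 1) - qcnj (s * r + s * qcnj r) * q"
    unfolding sum cnj_scaleR unfolding trace by (simp add: algebra_simps norm')
  moreover have "s * (p * r - qcnj s * q) + (s * p + q * qcnj r) * qcnj r
      = (s * r + s * qcnj r) * p + q * qcnj (r * r - n *\<^sub>R 1)"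
    unfolding sum square unfolding trace by (simp add: algebra_simps norm')
  ultimately show ?thesis
    by (simp add: octonion_eq_iff norm flip: p_def q_def r_def s_def)
qed

text \<open>
  The polarised form of right alternativity, obtained by comparing its instances
  at \<open>d\<close>, \<open>e\<close> and \<open>d + e\<close>.
\<close>

lemma octonion_right_mult_anticommute:
  fixes x d e :: octonion
  assumes "e * d = - (d * e)"
  shows "x * e * d = - (x * d * e)"
proof -
  have "x * (d + e) * (d + e) = x * ((d + e) * (d + e))"
    by (rule octonion_right_alternative)
  then have "x * e * d + x * d * e = 0"
    using octonion_right_alternative[of x d] octonion_right_alternative[of x e]
    by (simp add: octonion_bilinear_simps assms)
  then show ?thesis
    by (simp add: eq_neg_iff_add_eq_0)
qed

section \<open>Moving exponential factors\<close>

lemma mult_uexp: "x * uexp e a = cos a *\<^sub>R x + sin a *\<^sub>R (x * e)"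
  by (simp add: uexp_def octonion_bilinear_simps)

text \<open>
  Right alternativity gives \<open>x * e * e = - x\<close>, so this is the addition theorem for sine and cosine.
\<close>

lemma mult_uexp_uexp:
  assumes "e * e = - 1"
  shows "x * uexp e a * uexp e b = x * uexp e (a + b)"
proof -
  have "x * e * e = - x"
    by (simp add: octonion_right_alternative assms octonion_bilinear_simps)
  then show ?thesis
    by (simp add: mult_uexp octonion_bilinear_simps cos_add sin_add algebra_simps)
qed

lemma mult_uexp_unit:
  assumes "e * d = - (d * e)"
  shows "x * uexp e a * d = x * d * uexp e (- a)"
  by (simp add: mult_uexp octonion_bilinear_simps octonion_right_mult_anticommute[OF assms])

text \<open>
  Clearing the factor one half makes the coefficients of the expanded terms integral, so that
  the identities below reduce to cancellation of equal summands.
\<close>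

lemma eq_half_scaleR_iff: "x = (1/2) *\<^sub>R y \<longleftrightarrow> x + x = y" for x y :: "'a :: real_vector"
  by (auto simp flip: scaleR_2)

text \<open>
  The terms with \<open>\<delta>\<close> collect the cosine part of the factor with unit \<open>d\<close> and the
  terms with \<open>- \<delta>\<close> its sine part.
\<close>

lemma uexp_past_uexp:
  assumes "e * d = - (d * e)"
  shows "x * uexp e \<delta> * uexp d \<alpha> = (1/2) *\<^sub>R
    (x * uexp d \<alpha> * uexp e \<delta> + x * uexp d \<alpha> * uexp e (- \<delta>)
     + x * uexp d (- \<alpha>) * uexp e \<delta> - x * uexp d (- \<alpha>) * uexp e (- \<delta>))"
  unfolding eq_half_scaleR_iff
  by (simp add: mult_uexp[of _ d] mult_uexp_unit[OF assms] octonion_bilinear_simps algebra_simps)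

text \<open>
  Crossing two units restores the angle, so the \<open>\<delta>\<close> terms are those even in \<open>(\<alpha>, \<beta>)\<close>
  jointly and the \<open>- \<delta>\<close> terms those odd; hence only the simultaneous reflection occurs, and the
  sixteen terms of two separate crossings reduce to four.
\<close>

lemma uexp_past_two_uexp:
  assumes "e * d = - (d * e)" and "e * d' = - (d' * e)"
  shows "x * uexp e \<delta> * uexp d \<alpha> * uexp d' \<beta> = (1/2) *\<^sub>R
    (x * uexp d \<alpha> * uexp d' \<beta> * uexp e \<delta> + x * uexp d \<alpha> * uexp d' \<beta> * uexp e (- \<delta>)
     + x * uexp d (- \<alpha>) * uexp d' (- \<beta>) * uexp e \<delta>
     - x * uexp d (- \<alpha>) * uexp d' (- \<beta>) * uexp e (- \<delta>))"
proof -
  have "x * uexp e \<delta> * uexp d \<alpha> * uexp d' \<beta> =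
      (cos \<alpha> * cos \<beta>) *\<^sub>R (x * uexp e \<delta>) + (sin \<alpha> * sin \<beta>) *\<^sub>R (x * d * d' * uexp e \<delta>)
      + (sin \<alpha> * cos \<beta>) *\<^sub>R (x * d * uexp e (- \<delta>)) + (cos \<alpha> * sin \<beta>) *\<^sub>R (x * d' * uexp e (- \<delta>))"
    by (simp add: mult_uexp[of _ d] mult_uexp[of _ d'] mult_uexp_unit[OF assms(1)]
        mult_uexp_unit[OF assms(2)] octonion_bilinear_simps algebra_simps)
  then show ?thesis
    unfolding eq_half_scaleR_iff
    by (simp add: mult_uexp[of _ d] mult_uexp[of _ d'] octonion_bilinear_simps algebra_simps)
qed

section \<open>Integrability of the kernel\<close>

lemma integrable_mult_uexp:
  assumes v: "integrable M v" and g: "g \<in> borel_measurable M"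
  shows "integrable M (\<lambda>x. v x * uexp e (g x))"
proof -
  have bounded_mult: "integrable M (\<lambda>x. r x *\<^sub>R w x)"
    if "integrable M w" "r \<in> borel_measurable M" "\<And>x. \<bar>r x\<bar> \<le> 1"
    for w :: "_ \<Rightarrow> octonion" and r :: "_ \<Rightarrow> real"
  proof (rule Bochner_Integration.integrable_bound[OF that(1)])
    show "(\<lambda>x. r x *\<^sub>R w x) \<in> borel_measurable M"
      by (rule borel_measurable_scaleR[OF that(2) borel_measurable_integrable[OF that(1)]])
    show "AE x in M. norm (r x *\<^sub>R w x) \<le> norm (w x)"
      using that(3) by (simp add: mult_left_le_one_le)
  qed
  have "integrable M (\<lambda>x. v x * e)"
    by (rule integrable_bounded_linear[OF octonion_mult.bounded_linear_left v])
  then show ?thesis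
    unfolding mult_uexp using v g
    by (intro Bochner_Integration.integrable_add bounded_mult) auto
qed

lemma borel_measurable_lebesgue_phase:
  "(\<lambda>x :: real^3. - (c * x$k)) \<in> borel_measurable lebesgue"
proof -
  have "(\<lambda>x :: real^3. - (c * x$k)) \<in> borel_measurable borel"
    by (intro borel_measurable_continuous_onI continuous_intros)
  then show ?thesis
    by (simp add: measurable_completion)
qed

text \<open>
  Pointwise identities become identities between transforms through this form of linearity. The
  name \<open>K g\<close> for the integrand of \<open>OFT u g\<close> keeps the pointwise identity readable.
\<close>

lemma OFT_combination:
  assumes u: "integrable lebesgue u"
    and integrand: "\<And>x :: real^3.
      v x * uexp e1 (- (2 * pi * f$1 * x$1)) * uexp e2 (- (2 * pi * f$2 * x$2))
        * uexp e4 (- (2 * pi * f$3 * x$3)) = (1/2) *\<^sub>R (K a x + K b x + K c x - K d x)"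
    and K: "\<And>g x. K g x = u x * uexp e1 (- (2 * pi * g$1 * x$1))
      * uexp e2 (- (2 * pi * g$2 * x$2)) * uexp e4 (- (2 * pi * g$3 * x$3))"
  shows "OFT v f = (1/2) *\<^sub>R (OFT u a + OFT u b + OFT u c - OFT u d)"
proof -
  have int: "integrable lebesgue (K g)" for g
    unfolding K[abs_def] by (intro integrable_mult_uexp u borel_measurable_lebesgue_phase)
  have "OFT v f = (LINT x|lebesgue. (1/2) *\<^sub>R (K a x + K b x + K c x - K d x))"
    by (simp add: OFT_def integrand)
  also have "\<dots> = (1/2) *\<^sub>R (integral\<^sup>L lebesgue (K a) + integral\<^sup>L lebesgue (K b)
      + integral\<^sup>L lebesgue (K c) - integral\<^sup>L lebesgue (K d))"
    using int by simp
  finally show ?thesis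
    by (simp add: OFT_def K[abs_def])
qed

section \<open>The modulation theorem\<close>

theorem theorem12:
  fixes u :: "real^3 \<Rightarrow> octonion" and U :: "real^3 \<Rightarrow> octonion"
    and U_exp1 U_exp2 U_exp3 :: "real^3 \<Rightarrow> octonion"
    and f0 :: real
  assumes u: "integrable lebesgue u"
    and U: "U = OFT u"
    and U_exp1: "U_exp1 = OFT (\<lambda>x. u x * uexp e1 (- (2 * pi * f0 * x$1)))"
    and U_exp2: "U_exp2 = OFT (\<lambda>x. u x * uexp e2 (- (2 * pi * f0 * x$2)))"
    and U_exp3: "U_exp3 = OFT (\<lambda>x. u x * uexp e4 (- (2 * pi * f0 * x$3)))"
  shows "\<forall>f1 f2 f3 :: real.
      U_exp1 (vector [f1, f2, f3]) = U (vector [f1 + f0, f2, f3])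
    \<and> U_exp2 (vector [f1, f2, f3]) =
        (1/2) *\<^sub>R (U (vector [f1, f2 + f0, f3]) + U (vector [f1, f2 - f0, f3])
                 + U (vector [- f1, f2 + f0, f3]) - U (vector [- f1, f2 - f0, f3]))
    \<and> U_exp3 (vector [f1, f2, f3]) =
        (1/2) *\<^sub>R (U (vector [f1, f2, f3 + f0]) + U (vector [f1, f2, f3 - f0])
                 + U (vector [- f1, - f2, f3 + f0]) - U (vector [- f1, - f2, f3 - f0]))"
proof (intro allI conjI)
  fix f1 f2 f3 :: real
  define K where "K g x = u x * uexp e1 (- (2 * pi * g$1 * x$1))
      * uexp e2 (- (2 * pi * g$2 * x$2)) * uexp e4 (- (2 * pi * g$3 * x$3))" for g x :: "real^3"
  show "U_exp1 (vector [f1, f2, f3]) = U (vector [f1 + f0, f2, f3])"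
    unfolding U U_exp1 OFT_def by (simp add: mult_uexp_uexp octonion_units_mult algebra_simps)
  show "U_exp2 (vector [f1, f2, f3]) =
        (1/2) *\<^sub>R (U (vector [f1, f2 + f0, f3]) + U (vector [f1, f2 - f0, f3])
                 + U (vector [- f1, f2 + f0, f3]) - U (vector [- f1, f2 - f0, f3]))"
    unfolding U U_exp2
  proof (rule OFT_combination[where K = K, OF u _ K_def])
    fix x :: "real^3"
    have past: "e2 * e1 = - (e1 * e2)" and square: "e2 * e2 = - 1"
      by (simp_all add: octonion_units_mult)
    show "u x * uexp e2 (- (2 * pi * f0 * x$2))
        * uexp e1 (- (2 * pi * (vector [f1, f2, f3] :: real^3) $ 1 * x$1))
        * uexp e2 (- (2 * pi * (vector [f1, f2, f3] :: real^3) $ 2 * x$2))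
        * uexp e4 (- (2 * pi * (vector [f1, f2, f3] :: real^3) $ 3 * x$3))
      = (1/2) *\<^sub>R (K (vector [f1, f2 + f0, f3]) x + K (vector [f1, f2 - f0, f3]) x
        + K (vector [- f1, f2 + f0, f3]) x - K (vector [- f1, f2 - f0, f3]) x)"
      unfolding uexp_past_uexp[OF past] octonion_bilinear_simps
        mult_uexp_uexp[OF square] K_def vector_3
      by (simp add: algebra_simps)
  qed
  show "U_exp3 (vector [f1, f2, f3]) =
        (1/2) *\<^sub>R (U (vector [f1, f2, f3 + f0]) + U (vector [f1, f2, f3 - f0])
                 + U (vector [- f1, - f2, f3 + f0]) - U (vector [- f1, - f2, f3 - f0]))"
    unfolding U U_exp3
  proof (rule OFT_combination[where K = K, OF u _ K_def])
    fix x :: "real^3"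
    have past: "e4 * e1 = - (e1 * e4)" "e4 * e2 = - (e2 * e4)" and square: "e4 * e4 = - 1"
      by (simp_all add: octonion_units_mult)
    show "u x * uexp e4 (- (2 * pi * f0 * x$3))
        * uexp e1 (- (2 * pi * (vector [f1, f2, f3] :: real^3) $ 1 * x$1))
        * uexp e2 (- (2 * pi * (vector [f1, f2, f3] :: real^3) $ 2 * x$2))
        * uexp e4 (- (2 * pi * (vector [f1, f2, f3] :: real^3) $ 3 * x$3))
      = (1/2) *\<^sub>R (K (vector [f1, f2, f3 + f0]) x + K (vector [f1, f2, f3 - f0]) x
        + K (vector [- f1, - f2, f3 + f0]) x - K (vector [- f1, - f2, f3 - f0]) x)"
      unfolding uexp_past_two_uexp[OF past] octonion_bilinear_simps
        mult_uexp_uexp[OF square] K_def vector_3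
      by (simp add: algebra_simps)
  qed
qed

end
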